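(* The interval $C(v_i,v_j)$ is an MSI of a maximal chain $C$ of $[u,w]$ if and only if either $C(v_i,v_j)=v_{i+1}$ and $v_{i+1}$ is a strong descent, or $v_j=o(v_i)\not<i(v_i)$ and the sequence $l_{i+1},\ldots, l_j$ is decreasing.
   Context: Let $A$ be a set and $A^*$ the set of finite words over $A$, ordered by ordinary factor order: $u\le w$ if $u$ occurs in $w$ as a subsequence of consecutive letters. For a word $w$, the outer word $o(w)$ is the longest factor occurring both as a proper prefix and a proper suffix of $w$ (possibly empty), and the inner word is $i(w)=w(2)\cdots w(|w|-1)$. A word is flat if all its letters are equal. Let $[u,w]$ be an interval and $C: w=v_0\to v_1\to\cdots\to v_n=u$ a maximal chain, where each $v_k$ is recorded as an embedding into $w$ (a word of length $|w|$ over $A\cup\{0\}$ of the form $0^*v_k0^*$ agreeing with $w$ off the zeros). The label $l_k$ is the position of $w$ that is changed to $0$ in passing from the embedding of $v_{k-1}$ to that of $v_k$; when $v_{k-1}$ is flat, $l_k$ is taken to be the smaller of the two possible positions. The chain id is $l_1l_2\cdots l_n$, and maximal chains of $[u,w]$ are ordered lexicographically by chain id (a poset lexicographic order). For this order, a nonempty interval $C(v_i,v_j)$ of $C$ is a skipped interval if $C\setminus C(v_i,v_j)\subseteq C'$ for some maximal chain $C'<C$, and a minimally skipped interval (MSI) if it contains no other skipped interval properly. A word $v_k$ of the chain is a descent if $l_k>l_{k+1}$, and a strong descent if $l_k>l_{k+1}+1$. By convention, a sequence consisting of a single label is not decreasing. *)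

theory Defs
  imports Main "HOL-Library.Sublist"
begin

text \<open>
  The alphabet is the type \<^typ>\<open>'a\<close>; the factor order on words is \<^const>\<open>sublist\<close>.
\<close>

definition outer :: "'a list \<Rightarrow> 'a list" where
  "outer w = (ARG_MAX length x. strict_prefix x w \<and> strict_suffix x w)"

definition inner :: "'a list \<Rightarrow> 'a list" where
  "inner w = butlast (tl w)"

definition flat :: "'a list \<Rightarrow> bool" where
  "flat w \<longleftrightarrow> (\<forall>x\<in>set w. \<forall>y\<in>set w. x = y)"

definition factor_interval :: "'a list \<Rightarrow> 'a list \<Rightarrow> 'a list set" where
  "factor_interval u w = {v. sublist u v \<and> sublist v w}"

text \<open>A maximal chain, listed from top to bottom: \<open>C ! k\<close> is $v_k$, and $n$ is \<open>length C - 1\<close>.\<close>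

definition maximal_chain :: "'a list \<Rightarrow> 'a list \<Rightarrow> 'a list list \<Rightarrow> bool" where
  "maximal_chain u w C \<longleftrightarrow>
     pred_on.maxchain (factor_interval u w) strict_sublist (set C) \<and>
     sorted_wrt (\<lambda>x y. strict_sublist y x) C"

text \<open>The extra letter $0$ is \<^const>\<open>None\<close>.\<close>

definition is_embedding :: "'a list \<Rightarrow> 'a list \<Rightarrow> 'a option list \<Rightarrow> bool" where
  "is_embedding w v e \<longleftrightarrow>
     length e = length w \<and>
     (\<exists>a b. e = replicate a None @ map Some v @ replicate b None) \<and>
     (\<forall>p<length w. e ! p \<noteq> None \<longrightarrow> e ! p = Some (w ! p))"

text \<open>Positions of \<open>w\<close> are numbered from $1$, whereas list indices start at $0$.\<close>

definition zero_at :: "nat \<Rightarrow> 'a option list \<Rightarrow> 'a option list" where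
  "zero_at p e = e[p - 1 := None]"

definition admissible_position ::
    "'a list \<Rightarrow> 'a option list \<Rightarrow> 'a list \<Rightarrow> nat \<Rightarrow> bool" where
  "admissible_position w e v' p \<longleftrightarrow>
     1 \<le> p \<and> p \<le> length w \<and> e ! (p - 1) \<noteq> None \<and> is_embedding w v' (zero_at p e)"

text \<open>The label of the step from \<open>v\<close>, embedded as \<open>e\<close>, to \<open>v'\<close>.\<close>

definition step_label :: "'a list \<Rightarrow> 'a option list \<Rightarrow> 'a list \<Rightarrow> 'a list \<Rightarrow> nat" where
  "step_label w e v v' =
     (if flat v then (LEAST p. admissible_position w e v' p)
      else (THE p. admissible_position w e v' p))"

primrec chain_embedding :: "'a list \<Rightarrow> 'a list list \<Rightarrow> nat \<Rightarrow> 'a option list" where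
  "chain_embedding w C 0 = map Some w"
| "chain_embedding w C (Suc k) =
     zero_at (step_label w (chain_embedding w C k) (C ! k) (C ! Suc k)) (chain_embedding w C k)"

text \<open>\<open>label w C k\<close> is $l_k$, meaningful for $1 \le k \le n$.\<close>

definition label :: "'a list \<Rightarrow> 'a list list \<Rightarrow> nat \<Rightarrow> nat" where
  "label w C k = step_label w (chain_embedding w C (k - 1)) (C ! (k - 1)) (C ! k)"

definition chain_id :: "'a list \<Rightarrow> 'a list list \<Rightarrow> nat list" where
  "chain_id w C = map (label w C) [1..<length C]"

definition chain_less :: "'a list \<Rightarrow> 'a list list \<Rightarrow> 'a list list \<Rightarrow> bool" where
  "chain_less w C' C \<longleftrightarrow> (chain_id w C', chain_id w C) \<in> lexord less_than"

text \<open>The open interval $C(x,y)$, with the larger endpoint \<open>x\<close> first.\<close>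

definition chain_interval :: "'a list list \<Rightarrow> 'a list \<Rightarrow> 'a list \<Rightarrow> 'a list set" where
  "chain_interval C x y = {v \<in> set C. strict_sublist y v \<and> strict_sublist v x}"

definition skipped_interval ::
    "'a list \<Rightarrow> 'a list \<Rightarrow> 'a list list \<Rightarrow> 'a list set \<Rightarrow> bool" where
  "skipped_interval u w C I \<longleftrightarrow>
     (\<exists>i j. i < j \<and> j < length C \<and> I = chain_interval C (C ! i) (C ! j)) \<and> I \<noteq> {} \<and>
     (\<exists>C'. maximal_chain u w C' \<and> chain_less w C' C \<and> set C - I \<subseteq> set C')"

definition MSI :: "'a list \<Rightarrow> 'a list \<Rightarrow> 'a list list \<Rightarrow> 'a list set \<Rightarrow> bool" where
  "MSI u w C I \<longleftrightarrow>
     skipped_interval u w C I \<and> \<not> (\<exists>J. skipped_interval u w C J \<and> J \<subset> I)"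

definition strong_descent :: "'a list \<Rightarrow> 'a list list \<Rightarrow> nat \<Rightarrow> bool" where
  "strong_descent w C k \<longleftrightarrow>
     1 \<le> k \<and> k + 1 < length C \<and> label w C k > label w C (k + 1) + 1"

text \<open>By convention a sequence with a single label is not decreasing.\<close>

definition decreasing_labels :: "nat list \<Rightarrow> bool" where
  "decreasing_labels ls \<longleftrightarrow> length ls > 1 \<and> sorted_wrt (>) ls"

end

theory Submission
  imports Defs
begin

text \<open>
  Every step of a maximal chain deletes the last (R) or the first (L) letter of the current word,
  and a flat word counts as L. Two chains first differ at a step where one does R and the
  other L, and there the L-chain is the smaller one. Hence \<open>C(v\<^sub>i, v\<^sub>j)\<close> is skipped iff some
  \<open>v\<^sub>m\<close> with \<open>i \<le> m < j\<close> is left by R although \<open>v\<^sub>j\<close> is a factor of \<open>v\<^sub>m\<close> without its first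
  letter, and it is an MSI iff this happens for \<open>(m, j) = (i, j)\<close> and for no other pair inside.

  Labels increase after an L; they drop by one in RR and by the length of the word minus one in RL.
  If an MSI contains an L, the first RL already is a skipped interval with one element, so the MSI
  is RL. Otherwise \<open>v\<^sub>j\<close> is a prefix of \<open>v\<^sub>i\<close>, minimality in \<open>m\<close> says that it is no factor of
  \<open>i(v\<^sub>i)\<close>, so it is a border, and minimality in \<open>j\<close> says that it is the longest one.
\<close>

subsection \<open>Saturated chains of factors\<close>

text \<open>The factor order is graded by length, so covering can be stated without quantifying over
  words in between.\<close>

definition covers :: "'a list \<Rightarrow> 'a list \<Rightarrow> bool" where
  "covers x y \<longleftrightarrow> sublist y x \<and> length x = Suc (length y)"

text \<open>The step-by-step form of \<open>maximal_chain\<close>, to which it is equivalent when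
  \<open>sublist u w\<close>; it allows induction along the index.\<close>

definition saturated :: "'a list \<Rightarrow> 'a list \<Rightarrow> 'a list list \<Rightarrow> bool" where
  "saturated u w C \<longleftrightarrow> C \<noteq> [] \<and> hd C = w \<and> last C = u \<and> successively covers C"

lemma successively_nthD:
  "successively P xs \<Longrightarrow> Suc k < length xs \<Longrightarrow> P (xs ! k) (xs ! Suc k)"
  by (induction P xs arbitrary: k rule: successively.induct)
    (auto simp: nth_Cons split: nat.splits)

lemma successively_nthI:
  "(\<And>k. Suc k < length xs \<Longrightarrow> P (xs ! k) (xs ! Suc k)) \<Longrightarrow> successively P xs"
proof (induction P xs rule: successively.induct)
  case (3 P x y xs)
  have "P ((y # xs) ! k) ((y # xs) ! Suc k)" if "Suc k < length (y # xs)" for k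
    using "3.prems"[of "Suc k"] that by simp
  with "3.IH" "3.prems"[of 0] show ?case by simp
qed auto

lemma sublist_length_eq: "sublist x y \<Longrightarrow> length x = length y \<Longrightarrow> x = y"
  by (auto simp: sublist_def)

lemma strict_sublist_length: "strict_sublist x y \<Longrightarrow> length x < length y"
  using sublist_length_eq[of x y] sublist_length_le[of x y]
  by (auto simp: strict_sublist_def le_less)

text \<open>What surrounds \<open>y\<close> inside \<open>x\<close> has total length one, so the
  missing letter is an end letter. For a flat \<open>x\<close> both disjuncts hold.\<close>

lemma covers_cases: "covers x y \<Longrightarrow> y = tl x \<or> y = butlast x"
proof -
  assume "covers x y"
  then obtain ps ss where x: "x = ps @ y @ ss" and l: "length ps + length ss = 1"
    by (auto simp: covers_def sublist_def)
  from l consider "length ps = 0" "length ss = 1" | "length ps = 1" "length ss = 0" by linarith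
  then show ?thesis
    by cases (auto simp: x length_Suc_conv butlast_append)
qed

lemma covers_tl: "x \<noteq> [] \<Longrightarrow> covers x (tl x)"
  by (simp add: covers_def)

lemma sublist_tl_or_butlast:
  assumes "strict_sublist y x"
  shows "sublist y (tl x) \<or> sublist y (butlast x)"
proof -
  from assms obtain ps ss where x: "x = ps @ y @ ss" and "ps \<noteq> [] \<or> ss \<noteq> []"
    unfolding strict_sublist_def sublist_def by fastforce
  then show ?thesis by (auto simp: butlast_append)
qed

lemma ex_covers:
  assumes "strict_sublist y x"
  obtains z where "covers x z" "sublist y z"
proof -
  from strict_sublist_length[OF assms] have "x \<noteq> []" by auto
  then have "covers x (tl x)" "covers x (butlast x)"
    by (auto simp: covers_def)
  with sublist_tl_or_butlast[OF assms] that show ?thesis by blast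
qed

lemma ex_saturated: "sublist y x \<Longrightarrow> \<exists>D. saturated y x D"
proof (induction "length x" arbitrary: x)
  case 0
  then have "saturated y x [x]" by (auto simp: saturated_def)
  then show ?case ..
next
  case (Suc n)
  show ?case
  proof (cases "y = x")
    case True
    then have "saturated y x [x]" by (auto simp: saturated_def)
    then show ?thesis ..
  next
    case False
    with Suc.prems obtain z where z: "covers x z" "sublist y z"
      using ex_covers[of y x] by (auto simp: strict_sublist_def)
    then obtain D where "saturated y z D"
      using Suc.hyps by (auto simp: covers_def)
    with z have "saturated y x (x # D)"
      by (auto simp: saturated_def successively_Cons)
    then show ?thesis ..
  qed
qed

section \<open>Indices and lengths along a saturated chain\<close>

context
  fixes u w :: "'a list" and C
  assumes sat: "saturated u w C"
begin

lemma saturated_nth_0: "C ! 0 = w"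
  using sat by (auto simp: saturated_def hd_conv_nth)

lemma saturated_nth_last: "C ! (length C - Suc 0) = u"
  using sat by (auto simp: saturated_def last_conv_nth)

lemma saturated_length_pos: "0 < length C"
  using sat by (auto simp: saturated_def)

lemma saturated_covers: "Suc k < length C \<Longrightarrow> covers (C ! k) (C ! Suc k)"
  using sat by (auto simp: saturated_def intro: successively_nthD)

text \<open>Ties the index of an element to its length; order, injectivity and the matching of two
  chains are all read off from it.\<close>

lemma saturated_nth_length: "k < length C \<Longrightarrow> length (C ! k) + k = length w"
proof (induction k)
  case 0
  then show ?case by (simp add: saturated_nth_0)
next
  case (Suc k)
  then show ?case using saturated_covers[of k] by (simp add: covers_def)
qed

lemma saturated_sublist: "b < length C \<Longrightarrow> a \<le> b \<Longrightarrow> sublist (C ! b) (C ! a)"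
proof (induction "b - a" arbitrary: b)
  case 0
  then show ?case by simp
next
  case (Suc d)
  then have b: "b = Suc (b - 1)" "a \<le> b - 1" "d = b - 1 - a" "b - 1 < length C" by auto
  have "sublist (C ! b) (C ! (b - 1))"
    using saturated_covers[of "b - 1"] Suc.prems b(1) by (simp add: covers_def)
  with Suc.hyps(1)[OF b(3,4,2)] show ?case by (blast intro: sublist_order.order_trans)
qed

lemma saturated_strict_sublist_iff:
  assumes "a < length C" "b < length C"
  shows "strict_sublist (C ! b) (C ! a) \<longleftrightarrow> a < b"
proof
  assume "strict_sublist (C ! b) (C ! a)"
  from strict_sublist_length[OF this] show "a < b"
    using saturated_nth_length[OF assms(1)] saturated_nth_length[OF assms(2)] by linarith
next
  assume "a < b"
  moreover from this have "C ! b \<noteq> C ! a"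
    using saturated_nth_length[OF assms(1)] saturated_nth_length[OF assms(2)]
    by (metis add_left_cancel nat_neq_iff)
  ultimately show "strict_sublist (C ! b) (C ! a)"
    using saturated_sublist[of b a] assms by (simp add: strict_sublist_def)
qed

lemma saturated_inj: "inj_on ((!) C) {..<length C}"
  using saturated_nth_length by (auto simp: inj_on_def) (metis add_left_cancel)

lemma saturated_length: "length C = Suc (length w) - length u"
  using saturated_nth_length[of "length C - Suc 0"] saturated_length_pos
  unfolding saturated_nth_last by linarith

lemma saturated_chain_interval:
  assumes "i < length C" "j < length C"
  shows "chain_interval C (C ! i) (C ! j) = (!) C ` {i<..<j}"
proof (intro set_eqI iffI)
  fix x assume "x \<in> chain_interval C (C ! i) (C ! j)"
  then obtain k where "k < length C" "x = C ! k"
    "strict_sublist (C ! j) (C ! k)" "strict_sublist (C ! k) (C ! i)"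
    by (auto simp: chain_interval_def in_set_conv_nth)
  then show "x \<in> (!) C ` {i<..<j}" using assms by (auto simp: saturated_strict_sublist_iff)
next
  fix x assume "x \<in> (!) C ` {i<..<j}"
  then show "x \<in> chain_interval C (C ! i) (C ! j)"
    using assms by (auto simp: chain_interval_def saturated_strict_sublist_iff)
qed

text \<open>The lengths along \<open>C\<close> take every value from \<open>length w\<close> down to
  \<open>length u\<close>. A further comparable word would share its length with an element of
  \<open>C\<close>, hence be equal to it.\<close>

lemma saturated_imp_maximal_chain: "maximal_chain u w C"
proof -
  have "pred_on.chain (factor_interval u w) strict_sublist (set C)"
    unfolding pred_on.chain_def
  proof (intro conjI ballI subsetI)
    fix x assume "x \<in> set C"
    then obtain k where "k < length C" "x = C ! k" by (auto simp: in_set_conv_nth)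
    then show "x \<in> factor_interval u w"
      using saturated_sublist[of k 0] saturated_sublist[of "length C - Suc 0" k]
      by (auto simp: factor_interval_def saturated_nth_0 saturated_nth_last)
  next
    fix x y assume "x \<in> set C" "y \<in> set C"
    then obtain k l where "k < length C" "x = C ! k" "l < length C" "y = C ! l"
      by (auto simp: in_set_conv_nth)
    then show "strict_sublist\<^sup>=\<^sup>= x y \<or> strict_sublist\<^sup>=\<^sup>= y x"
      using saturated_strict_sublist_iff[of k l] saturated_strict_sublist_iff[of l k]
      by (cases k l rule: linorder_cases) auto
  qed
  moreover have False
    if S: "pred_on.chain (factor_interval u w) strict_sublist S" "set C \<subset> S" for S
  proof -
    from S(2) obtain s where s: "s \<in> S" "s \<notin> set C" by blast
    with S(1) have "sublist u s" "sublist s w"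
      by (auto simp: pred_on.chain_def factor_interval_def)
    then have le: "length u \<le> length s" "length s \<le> length w" by (auto intro: sublist_length_le)
    define k where "k = length w - length s"
    have k: "k < length C" using le saturated_length by (auto simp: k_def)
    then have "length (C ! k) = length s" using saturated_nth_length[of k] le by (simp add: k_def)
    moreover have "C ! k \<in> S" using k S(2) by (meson nth_mem psubsetD)
    ultimately have "C ! k = s"
      using S(1) s(1) strict_sublist_length[of "C ! k" s] strict_sublist_length[of s "C ! k"]
      unfolding pred_on.chain_def by fastforce
    with k s(2) show False by auto
  qed
  moreover have "sorted_wrt (\<lambda>x y. strict_sublist y x) C"
    by (auto simp: sorted_wrt_iff_nth_less saturated_strict_sublist_iff)
  ultimately show ?thesis
    by (auto simp: maximal_chain_def pred_on.maxchain_def)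
qed

end

text \<open>A word of the interval comparable with every element must already belong to a maximal
  chain. This is applied to \<open>w\<close>, to \<open>u\<close>, and to a word one letter below
  \<open>C ! k\<close> that lies above \<open>C ! Suc k\<close>.\<close>

lemma maximal_chain_imp_saturated:
  assumes uw: "sublist u w" and max: "maximal_chain u w C"
  shows "saturated u w C"
proof -
  have chain: "pred_on.chain (factor_interval u w) strict_sublist (set C)"
    and sorted: "sorted_wrt (\<lambda>x y. strict_sublist y x) C"
    and maxi: "\<And>S. pred_on.chain (factor_interval u w) strict_sublist S \<Longrightarrow> \<not> set C \<subset> S"
    using max by (auto simp: maximal_chain_def pred_on.maxchain_def)
  have mem: "z \<in> set C" if z: "sublist u z" "sublist z w"
    and cmp: "\<And>x. x \<in> set C \<Longrightarrow> sublist x z \<or> sublist z x" for z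
  proof -
    have "pred_on.chain (factor_interval u w) strict_sublist (insert z (set C))"
      using chain z cmp unfolding pred_on.chain_def
      by (auto simp: factor_interval_def strict_sublist_def)
    from maxi[OF this] show ?thesis by blast
  qed
  have bounds: "sublist u x \<and> sublist x w" if "x \<in> set C" for x
    using chain that by (auto simp: pred_on.chain_def factor_interval_def)
  have strict: "strict_sublist (C ! b) (C ! a)" if "a < b" "b < length C" for a b
    using sorted_wrt_nth_less[OF sorted] that by auto
  have wC: "w \<in> set C" using bounds uw by (intro mem) simp_all
  have uC: "u \<in> set C" using bounds uw by (intro mem) simp_all
  have ne: "C \<noteq> []" using wC by auto
  have hd: "hd C = w"
  proof -
    obtain k where k: "k < length C" "C ! k = w" using wC by (auto simp: in_set_conv_nth)
    have "\<not> 0 < k"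
      using strict[of 0 k] k bounds[of "C ! 0"] ne by (auto simp: sublist_order.less_le_not_le)
    with k ne show ?thesis by (simp add: hd_conv_nth)
  qed
  have last: "last C = u"
  proof -
    obtain k where k: "k < length C" "C ! k = u" using uC by (auto simp: in_set_conv_nth)
    have "\<not> k < length C - 1"
      using strict[of k "length C - 1"] k bounds[of "C ! (length C - 1)"] ne
      by (auto simp: sublist_order.less_le_not_le)
    with k have "k = length C - 1" by auto
    with k ne show ?thesis by (simp add: last_conv_nth)
  qed
  have "covers (C ! k) (C ! Suc k)" if k: "Suc k < length C" for k
  proof -
    obtain z where z: "covers (C ! k) z" "sublist (C ! Suc k) z"
      using ex_covers strict[OF lessI k] by blast
    have below: "sublist (C ! b) (C ! a)" if "a \<le> b" "b < length C" for a b
      using strict[of a b] that by (cases "a = b") (auto simp: strict_sublist_def)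
    have zk: "sublist z (C ! k)" using z(1) by (simp add: covers_def)
    have "z \<in> set C"
    proof (rule mem)
      show "sublist u z" using z(2) bounds[of "C ! Suc k"] k
        by (meson nth_mem sublist_order.order_trans)
      show "sublist z w" using zk bounds[of "C ! k"] k
        by (meson Suc_lessD nth_mem sublist_order.order_trans)
    next
      fix x assume "x \<in> set C"
      then obtain m where m: "m < length C" "x = C ! m" by (auto simp: in_set_conv_nth)
      show "sublist x z \<or> sublist z x"
      proof (cases "m \<le> k")
        case True
        then show ?thesis using below[of m k] zk k m
          by (meson Suc_lessD sublist_order.order_trans)
      next
        case False
        then show ?thesis using below[of "Suc k" m] z(2) m
          by (meson not_less_eq_eq sublist_order.order_trans)
      qed
    qed
    then obtain m where m: "m < length C" "z = C ! m" by (auto simp: in_set_conv_nth)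
    have "k < m" using below[of m k] z(1) k m sublist_length_le[of "C ! k" z]
      by (auto simp: covers_def not_less[symmetric])
    moreover have "\<not> Suc k < m" using strict[of "Suc k" m] m z(2)
      by (auto simp: sublist_order.less_le_not_le)
    ultimately have "m = Suc k" by simp
    with m z(1) show ?thesis by simp
  qed
  with ne hd last show ?thesis by (auto simp: saturated_def intro: successively_nthI)
qed

subsection \<open>Embeddings and labels\<close>

text \<open>The embedding of the factor of length \<open>l\<close> that starts at list index
  \<open>a\<close>, counted from 0. Two numbers thus stand for the whole embedding.\<close>

definition window :: "'a list \<Rightarrow> nat \<Rightarrow> nat \<Rightarrow> 'a option list" where
  "window w a l = map (\<lambda>p. if a \<le> p \<and> p < a + l then Some (w ! p) else None) [0..<length w]"

lemma length_window [simp]: "length (window w a l) = length w"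
  by (simp add: window_def)

lemma nth_window [simp]:
  "p < length w \<Longrightarrow> window w a l ! p = (if a \<le> p \<and> p < a + l then Some (w ! p) else None)"
  by (simp add: window_def)

lemma window_eq_append:
  assumes "a + l \<le> length w"
  shows "window w a l =
    replicate a None @ map Some (take l (drop a w)) @ replicate (length w - a - l) None"
  using assms by (intro nth_equalityI) (auto simp: nth_append)

text \<open>The number of zeros in front serves as \<open>a\<close>; agreement with \<open>w\<close>
  off the zeros then determines \<open>v\<close>. For \<open>v = []\<close> this \<open>a\<close> is
  not unique.\<close>

lemma is_embedding_iff_window:
  "is_embedding w v e \<longleftrightarrow>
    (\<exists>a. a + length v \<le> length w \<and> v = take (length v) (drop a w) \<and> e = window w a (length v))"
proof
  assume "is_embedding w v e"
  then obtain a b where len: "length e = length w"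
    and e: "e = replicate a None @ map Some v @ replicate b None"
    and agree: "\<And>p. p < length w \<Longrightarrow> e ! p \<noteq> None \<Longrightarrow> e ! p = Some (w ! p)"
    by (auto simp: is_embedding_def)
  have l: "a + length v + b = length w" using len e by simp
  have v: "v = take (length v) (drop a w)"
  proof (rule nth_equalityI)
    show "length v = length (take (length v) (drop a w))" using l by simp
    fix q assume "q < length v"
    then show "v ! q = take (length v) (drop a w) ! q"
      using agree[of "a + q"] l by (simp add: e nth_append)
  qed
  have "e = window w a (length v)"
    using window_eq_append[of a "length v" w] l v e by (simp add: add.commute)
  with l v show "\<exists>a. a + length v \<le> length w \<and> v = take (length v) (drop a w) \<and>
      e = window w a (length v)"
    by (intro exI[of _ a]) simp
next
  assume "\<exists>a. a + length v \<le> length w \<and> v = take (length v) (drop a w) \<and>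
      e = window w a (length v)"
  then obtain a where a: "a + length v \<le> length w" "v = take (length v) (drop a w)"
    "e = window w a (length v)" by blast
  have "e = replicate a None @ map Some v @ replicate (length w - a - length v) None"
    using window_eq_append[OF a(1)] a(2,3) by simp
  moreover have "\<forall>p<length w. e ! p \<noteq> None \<longrightarrow> e ! p = Some (w ! p)" "length e = length w"
    by (simp_all add: a(3))
  ultimately show "is_embedding w v e"
    unfolding is_embedding_def by blast
qed

text \<open>Positions count from 1 but \<open>a\<close> counts from 0, so position
  \<open>Suc a\<close> is the first letter of the block.\<close>

lemma zero_at_first: "0 < l \<Longrightarrow> zero_at (Suc a) (window w a l) = window w (Suc a) (l - 1)"
proof (rule nth_equalityI)
  fix i assume "0 < l" "i < length (zero_at (Suc a) (window w a l))"
  then show "zero_at (Suc a) (window w a l) ! i = window w (Suc a) (l - 1) ! i"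
    by (cases "i = a") (auto simp: zero_at_def)
qed (simp add: zero_at_def)

lemma zero_at_last: "0 < l \<Longrightarrow> zero_at (a + l) (window w a l) = window w a (l - 1)"
proof (rule nth_equalityI)
  fix i assume "0 < l" "i < length (zero_at (a + l) (window w a l))"
  then show "zero_at (a + l) (window w a l) ! i = window w a (l - 1) ! i"
    by (cases "i = a + l - 1") (auto simp: zero_at_def)
qed (simp add: zero_at_def)

lemma tl_take_drop: "tl (take l (drop a w)) = take (l - 1) (drop (Suc a) w)"
  by (cases l) (auto simp: tl_take drop_Suc tl_drop)

lemma butlast_take_drop:
  "a + l \<le> length w \<Longrightarrow> butlast (take l (drop a w)) = take (l - 1) (drop a w)"
  by (simp add: butlast_take)

text \<open>Zeroing a letter strictly inside the block would leave letters on both sides of a zero,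
  which no embedding allows. Only the two ends remain.\<close>

lemma admissible_position_window:
  assumes al: "a + l \<le> length w" and v: "v = take l (drop a w)" and l: "l = Suc (length v')"
  shows "admissible_position w (window w a l) v' p \<longleftrightarrow>
    (p = Suc a \<and> v' = tl v) \<or> (p = a + l \<and> v' = butlast v)"
proof
  assume "admissible_position w (window w a l) v' p"
  then have p: "1 \<le> p" "p \<le> length w" "window w a l ! (p - 1) \<noteq> None"
    and emb: "is_embedding w v' (zero_at p (window w a l))"
    by (auto simp: admissible_position_def)
  have pr: "a < p" "p \<le> a + l" using p by (auto split: if_splits)
  from emb obtain a' where a': "a' + length v' \<le> length w" "take (length v') (drop a' w) = v'"
    "zero_at p (window w a l) = window w a' (length v')"
    unfolding is_embedding_iff_window by metis
  have pos: "(a \<le> q \<and> q < a + l \<and> q \<noteq> p - 1) = (a' \<le> q \<and> q < a' + length v')"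
    if "q < length w" for q
  proof -
    have "zero_at p (window w a l) ! q = window w a' (length v') ! q" by (simp add: a'(3))
    with that p(1,2) show ?thesis
      by (auto simp: zero_at_def nth_list_update split: if_splits)
  qed
  show "(p = Suc a \<and> v' = tl v) \<or> (p = a + l \<and> v' = butlast v)"
  \<comment> \<open>An empty \<open>v'\<close> leaves no letter from which to recover
    \<open>a'\<close>, but then \<open>l = 1\<close> and both ends are position
    \<open>Suc a\<close>.\<close>
  proof (cases "v' = []")
    case True
    then show ?thesis using l pr v by (auto simp: tl_take_drop)
  next
    case False
    consider "p = Suc a" | "p = a + l" | "a < p - 1" "p < a + l" using pr l by linarith
    then show ?thesis
    proof cases
      case 1
      have "a' = Suc a"
        using pos[of a'] pos[of "Suc a"] pos[of a] False l al 1 a'(1) by (cases v') auto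
      then show ?thesis using 1 a'(2) l v by (simp add: tl_take_drop)
    next
      case 2
      have "a' = a"
        using pos[of a'] pos[of a] False l al 2 a'(1) by (cases v') auto
      then show ?thesis using 2 a'(2) l v butlast_take_drop[OF al] by simp
    next
      \<comment> \<open>The letters at indices \<open>a\<close> and \<open>p\<close> survive, so the
        new block would contain the index \<open>p - 1\<close> between them, which was
        zeroed.\<close>
      case 3
      then have "a < length w" "0 < l" "a \<noteq> p - 1" using al by linarith+
      then have "a' \<le> a" using pos[of a] by simp
      moreover have "p < a' + length v'" using pos[of p] 3 al by auto
      moreover have "p - 1 < length w" using 3 al by linarith
      ultimately have False using pos[of "p - 1"] 3 by auto
      then show ?thesis ..
    qed
  qed
next
  assume "(p = Suc a \<and> v' = tl v) \<or> (p = a + l \<and> v' = butlast v)"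
  then show "admissible_position w (window w a l) v' p"
  proof (elim disjE conjE)
    assume p: "p = Suc a" "v' = tl v"
    then have "v' = take (length v') (drop (Suc a) w)"
      using l v by (simp add: tl_take_drop)
    moreover have "zero_at p (window w a l) = window w (Suc a) (length v')"
      using p(1) l zero_at_first[of l a w] by simp
    moreover have "Suc a + length v' \<le> length w" using al l by simp
    ultimately have "is_embedding w v' (zero_at p (window w a l))"
      unfolding is_embedding_iff_window by blast
    then show ?thesis using p(1) al l by (simp add: admissible_position_def)
  next
    assume p: "p = a + l" "v' = butlast v"
    have "l - 1 = length v'" using l by simp
    then have "v' = take (length v') (drop a w)"
      using p(2) butlast_take_drop[OF al] unfolding v by metis
    moreover have "zero_at p (window w a l) = window w a (length v')"
      using p(1) l zero_at_last[of l a w] by simp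
    moreover have "a + length v' \<le> length w" using al l by simp
    ultimately have "is_embedding w v' (zero_at p (window w a l))"
      unfolding is_embedding_iff_window by blast
    then show ?thesis using p(1) al l by (simp add: admissible_position_def)
  qed
qed

lemma flat_iff_tl_eq_butlast: "v \<noteq> [] \<Longrightarrow> flat v \<longleftrightarrow> tl v = butlast v"
proof (induction v)
  case (Cons x v)
  then show ?case by (cases v) (auto simp: flat_def)
qed simp

text \<open>The test \<open>v' = tl v\<close> respects the convention for flat words: there both
  ends are admissible and the minimum is the left one. Otherwise exactly one end is
  admissible.\<close>

lemma step_label_window:
  assumes al: "a + l \<le> length w" and v: "v = take l (drop a w)" and cov: "covers v v'"
  shows "step_label w (window w a l) v v' = (if v' = tl v then Suc a else a + l)"
proof -
  have l: "l = Suc (length v')" using cov al v by (simp add: covers_def)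
  note adm = admissible_position_window[OF al v l]
  have ne: "v \<noteq> []" using cov by (auto simp: covers_def)
  show ?thesis
  proof (cases "flat v")
    case True
    then have "tl v = butlast v" using ne by (simp add: flat_iff_tl_eq_butlast)
    with covers_cases[OF cov] have v': "v' = tl v" by auto
    have "(LEAST p. admissible_position w (window w a l) v' p) = Suc a"
      unfolding adm by (rule Least_equality) (use v' l in auto)
    with True v' show ?thesis by (simp add: step_label_def)
  next
    case False
    then have "tl v \<noteq> butlast v" using ne by (simp add: flat_iff_tl_eq_butlast)
    then have "admissible_position w (window w a l) v' p \<longleftrightarrow>
        p = (if v' = tl v then Suc a else a + l)" for p
      unfolding adm using covers_cases[OF cov] by auto
    then have "(THE p. admissible_position w (window w a l) v' p) =
        (if v' = tl v then Suc a else a + l)"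
      by (intro the_equality) blast+
    with False show ?thesis by (simp add: step_label_def)
  qed
qed

text \<open>Counts the left deletions among the first \<open>k\<close> steps, which is where the
  letter block of the \<open>k\<close>-th embedding starts.\<close>

primrec offset :: "'a list list \<Rightarrow> nat \<Rightarrow> nat" where
  "offset C 0 = 0"
| "offset C (Suc k) = (if C ! Suc k = tl (C ! k) then Suc (offset C k) else offset C k)"

lemma chain_embedding_window:
  assumes sat: "saturated u w C"
  shows "k < length C \<Longrightarrow> chain_embedding w C k = window w (offset C k) (length (C ! k)) \<and>
    C ! k = take (length (C ! k)) (drop (offset C k) w) \<and>
    offset C k + length (C ! k) \<le> length w"
proof (induction k)
  case 0
  have "map Some w = window w 0 (length w)" by (intro nth_equalityI) auto
  with saturated_nth_0[OF sat] show ?case by simp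
next
  case (Suc k)
  let ?a = "offset C k" and ?v = "C ! k" and ?v' = "C ! Suc k"
  have IH: "chain_embedding w C k = window w ?a (length ?v)"
    "?v = take (length ?v) (drop ?a w)" "?a + length ?v \<le> length w"
    using Suc by auto
  have cov: "covers ?v ?v'" using saturated_covers[OF sat Suc.prems] .
  have l: "length ?v = Suc (length ?v')" using cov by (simp add: covers_def)
  have step: "chain_embedding w C (Suc k) =
      zero_at (if ?v' = tl ?v then Suc ?a else ?a + length ?v) (window w ?a (length ?v))"
    using step_label_window[OF IH(3,2) cov] IH(1) by simp
  show ?case
  proof (cases "?v' = tl ?v")
    case True
    moreover have "tl ?v = take (length ?v') (drop (Suc ?a) w)"
      using tl_take_drop[of "length ?v" ?a w] IH(2) l by simp
    ultimately show ?thesis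
      using step IH(3) l zero_at_first[of "length ?v" ?a w] by simp
  next
    case False
    then have "?v' = butlast ?v" using covers_cases[OF cov] by simp
    moreover have "butlast ?v = take (length ?v') (drop ?a w)"
      using butlast_take_drop[OF IH(3)] IH(2) l by simp
    ultimately show ?thesis
      using False step IH(3) l zero_at_last[of "length ?v" ?a w] by simp
  qed
qed

lemma label_saturated:
  assumes sat: "saturated u w C" and k: "Suc k < length C"
  shows "label w C (Suc k) =
    (if C ! Suc k = tl (C ! k) then Suc (offset C k) else offset C k + length (C ! k))"
proof -
  note emb = chain_embedding_window[OF sat Suc_lessD[OF k]]
  show ?thesis
    using step_label_window[OF _ _ saturated_covers[OF sat k], of "offset C k" "length (C ! k)" w]
      emb by (simp add: label_def)
qed

subsection \<open>Comparing chains\<close>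

text \<open>The chain ids have equal length, so the proper-prefix case of \<open>lexord\<close>
  cannot occur and a first difference decides.\<close>

lemma chain_less_iff_label:
  assumes "length C' = length C"
  shows "chain_less w C' C \<longleftrightarrow>
    (\<exists>k. Suc k < length C \<and> (\<forall>m<k. label w C' (Suc m) = label w C (Suc m)) \<and>
      label w C' (Suc k) < label w C (Suc k))"
proof -
  have nth: "chain_id w D ! k = label w D (Suc k)" if "Suc k < length D" for D k
    using that by (simp add: chain_id_def)
  have len: "length (chain_id w D) = length D - 1" for D
    by (simp add: chain_id_def)
  have take: "take k (chain_id w C') = take k (chain_id w C) \<longleftrightarrow>
      (\<forall>m<k. label w C' (Suc m) = label w C (Suc m))" if "Suc k < length C" for k
    using that assms by (auto simp: list_eq_iff_nth_eq len nth)
  have "chain_less w C' C \<longleftrightarrow>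
    (\<exists>k<length C - 1. take k (chain_id w C') = take k (chain_id w C) \<and>
      chain_id w C' ! k < chain_id w C ! k)"
    by (auto simp: chain_less_def lexord_take_index_conv len assms)
  also have "\<dots> \<longleftrightarrow> (\<exists>k. Suc k < length C \<and>
      (\<forall>m<k. label w C' (Suc m) = label w C (Suc m)) \<and>
      label w C' (Suc k) < label w C (Suc k))"
    using assms by (intro iff_exI) (auto simp: take nth less_diff_conv)
  finally show ?thesis .
qed

lemma offset_cong: "(\<And>m. m \<le> k \<Longrightarrow> C' ! m = C ! m) \<Longrightarrow> offset C' k = offset C k"
  by (induction k) auto

text \<open>Given the current word and offset, a label tells left from right, so the labels
  reconstruct the chain step by step.\<close>

lemma eq_labels_imp_eq_chain:
  assumes C: "saturated u w C" and C': "saturated u w C'"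
    and "k < length C" "\<And>m. m < k \<Longrightarrow> label w C' (Suc m) = label w C (Suc m)"
  shows "\<forall>m\<le>k. C' ! m = C ! m"
  using assms(3,4)
proof (induction k)
  case 0
  then show ?case using saturated_nth_0[OF C] saturated_nth_0[OF C'] by simp
next
  case (Suc k)
  have IH: "\<forall>m\<le>k. C' ! m = C ! m" using Suc by simp
  then have off: "offset C' k = offset C k" by (intro offset_cong) simp
  have len: "length C' = length C"
    using saturated_length[OF C] saturated_length[OF C'] by simp
  have k: "Suc k < length C" "Suc k < length C'" using Suc.prems len by auto
  have eq: "C' ! k = C ! k" using IH by simp
  note cov = saturated_covers[OF C k(1)] saturated_covers[OF C' k(2)]
  have "C' ! Suc k = C ! Suc k"
  \<comment> \<open>For a one-letter word both labels coincide, but either deletion leaves the empty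
    word.\<close>
  proof (cases "length (C ! k) = 1")
    case True
    then show ?thesis using cov eq by (simp add: covers_def)
  next
    case False
    then have "C' ! Suc k = tl (C ! k) \<longleftrightarrow> C ! Suc k = tl (C ! k)"
      using Suc.prems(2)[of k] label_saturated[OF C k(1)] label_saturated[OF C' k(2)] off eq
      by (auto split: if_splits)
    then show ?thesis using covers_cases[OF cov(1)] covers_cases[OF cov(2)] eq by metis
  qed
  with IH show ?case by (auto simp: le_Suc_eq)
qed

text \<open>At the first difference both chains share word and offset. There the left label is below
  the right one, since a one-letter word admits no difference.\<close>

lemma chain_less_iff:
  assumes C: "saturated u w C" and C': "saturated u w C'"
  shows "chain_less w C' C \<longleftrightarrow>
    (\<exists>k. Suc k < length C \<and> (\<forall>m\<le>k. C' ! m = C ! m) \<and>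
      C' ! Suc k = tl (C ! k) \<and> C ! Suc k \<noteq> tl (C ! k))"
proof -
  have len: "length C' = length C"
    using saturated_length[OF C] saturated_length[OF C'] by simp
  have "(\<forall>m<k. label w C' (Suc m) = label w C (Suc m)) \<and> label w C' (Suc k) < label w C (Suc k)
    \<longleftrightarrow> (\<forall>m\<le>k. C' ! m = C ! m) \<and> C' ! Suc k = tl (C ! k) \<and> C ! Suc k \<noteq> tl (C ! k)"
    (is "?L \<longleftrightarrow> ?R") if k: "Suc k < length C" for k
  proof
    assume L: ?L
    then have eq: "\<forall>m\<le>k. C' ! m = C ! m"
      using eq_labels_imp_eq_chain[OF C C', of k] k by simp
    then have "offset C' k = offset C k" by (intro offset_cong) simp
    moreover have "C ! k \<noteq> []" using saturated_covers[OF C k] by (auto simp: covers_def)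
    ultimately show ?R
      using L eq label_saturated[OF C k] label_saturated[OF C', of k] k len
      by (auto simp: Suc_le_eq split: if_splits)
  next
    assume R: ?R
    have off: "offset C' m = offset C m" if "m \<le> k" for m
      using R that by (intro offset_cong) simp
    have "label w C' (Suc m) = label w C (Suc m)" if "m < k" for m
      using label_saturated[OF C, of m] label_saturated[OF C', of m] R that k len off[of m]
      by simp
    moreover have "length (C ! k) \<noteq> 1" "C ! k \<noteq> []"
      using R saturated_covers[OF C k] by (auto simp: covers_def length_Suc_conv)
    then have "1 < length (C ! k)" by (cases "length (C ! k)") auto
    then have "label w C' (Suc k) < label w C (Suc k)"
      using label_saturated[OF C k] label_saturated[OF C', of k] R k len off[of k] by simp
    ultimately show ?L by blast
  qed
  then show ?thesis unfolding chain_less_iff_label[OF len] by blast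
qed

subsection \<open>Skipped intervals\<close>

text \<open>\<open>C\<close> deletes the last letter of \<open>C ! m\<close> although deleting the
  first would still lead to \<open>C ! j\<close>: a smaller chain can branch off at \<open>m\<close>
  and rejoin at \<open>j\<close>.\<close>

definition shortcut :: "'a list list \<Rightarrow> nat \<Rightarrow> nat \<Rightarrow> bool" where
  "shortcut C m j \<longleftrightarrow> m < j \<and> C ! Suc m \<noteq> tl (C ! m) \<and> sublist (C ! j) (tl (C ! m))"

context
  fixes u w :: "'a list" and C
  assumes sat: "saturated u w C"
begin

text \<open>For \<open>j = Suc m\<close> equal lengths would force
  \<open>C ! j = tl (C ! m)\<close>. Hence a shortcut always bypasses some element.\<close>

lemma shortcut_gap:
  assumes "shortcut C m j" "j < length C"
  shows "Suc m < j"
proof (rule ccontr)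
  assume "\<not> Suc m < j"
  with assms have j: "j = Suc m" by (auto simp: shortcut_def)
  then have "C ! j = tl (C ! m)"
    using assms saturated_covers[OF sat, of m]
    by (intro sublist_length_eq) (auto simp: shortcut_def covers_def)
  with assms j show False by (simp add: shortcut_def)
qed

text \<open>A detour is spliced into \<open>C\<close>; it begins with the left deletion at
  \<open>m\<close>, which makes the new chain smaller.\<close>

lemma shortcut_imp_chain:
  assumes sc: "shortcut C m j" and j: "j < length C"
  shows "\<exists>C'. saturated u w C' \<and> chain_less w C' C \<and>
    (\<forall>k<length C. k \<le> m \<or> j \<le> k \<longrightarrow> C ! k \<in> set C')"
proof -
  have m: "Suc m < j" using shortcut_gap[OF sc j] .
  obtain D where D: "saturated (C ! j) (tl (C ! m)) D"
    using ex_saturated sc by (auto simp: shortcut_def)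
  \<comment> \<open>\<open>D\<close> runs from \<open>tl (C ! m)\<close> to \<open>C ! j\<close>
    inclusive, so the old chain resumes at \<open>Suc j\<close>.\<close>
  define C' where "C' = take (Suc m) C @ D @ drop (Suc j) C"
  have Dne: "D \<noteq> []" using D by (simp add: saturated_def)
  have succ: "successively covers (take (Suc m) C)" "successively covers (drop (Suc j) C)"
    using saturated_covers[OF sat] j m by (auto intro!: successively_nthI)
  have lastt: "last (take (Suc m) C) = C ! m" using m j by (simp add: take_Suc_conv_app_nth)
  have hdd: "hd (drop (Suc j) C) = C ! Suc j" if "Suc j < length C"
    using that by (simp add: hd_drop_conv_nth)
  have "C ! m \<noteq> []" using saturated_covers[OF sat, of m] m j by (auto simp: covers_def)
  then have "covers (C ! m) (tl (C ! m))" by (rule covers_tl)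
  moreover have "drop (Suc j) C = [] \<or> covers (C ! j) (hd (drop (Suc j) C))"
    using hdd saturated_covers[OF sat, of j] by (cases "Suc j < length C") auto
  ultimately have "successively covers C'"
    using succ D lastt
    by (auto simp: C'_def successively_append_iff saturated_def hd_append)
  moreover have "hd C' = w"
    using sat m j by (auto simp: C'_def saturated_def hd_append)
  moreover have "last C' = u"
  proof (cases "Suc j < length C")
    case True
    then show ?thesis using sat by (simp add: C'_def saturated_def)
  next
    case False
    with j have "j = length C - Suc 0" by simp
    then show ?thesis using D Dne False saturated_nth_last[OF sat]
      by (simp add: C'_def saturated_def)
  qed
  ultimately have C': "saturated u w C'" using Dne by (simp add: saturated_def C'_def)
  have pre: "C' ! k = C ! k" if "k \<le> m" for k
    using that m j by (simp add: C'_def nth_append)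
  have next_m: "C' ! Suc m = tl (C ! m)"
    using D Dne m j by (simp add: C'_def nth_append saturated_def hd_conv_nth)
  have "chain_less w C' C"
    unfolding chain_less_iff[OF sat C'] using pre next_m sc m j
    by (intro exI[of _ m]) (simp add: shortcut_def)
  moreover have "C ! k \<in> set C'" if k: "k < length C" "k \<le> m \<or> j \<le> k" for k
  proof -
    consider "k \<le> m" | "k = j" | "Suc j \<le> k" using k by linarith
    then show ?thesis
    proof cases
      case 1
      then have "C ! k = take (Suc m) C ! k" "k < length (take (Suc m) C)" using m j by auto
      then show ?thesis unfolding C'_def by (metis UnI1 nth_mem set_append)
    next
      case 2
      then have "C ! k = last D" using D by (simp add: saturated_def)
      then show ?thesis using Dne by (simp add: C'_def)
    next
      case 3
      then have "C ! k = drop (Suc j) C ! (k - Suc j)" "k - Suc j < length (drop (Suc j) C)"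
        using k by auto
      then show ?thesis unfolding C'_def by (metis UnI2 nth_mem set_append)
    qed
  qed
  ultimately show ?thesis using C' by blast
qed

text \<open>The smaller chain leaves \<open>C\<close> by a left deletion inside the interval and is
  back at \<open>j\<close>, which gives a shortcut. Conversely, the detour of a shortcut from
  \<open>m \<ge> i\<close> keeps everything outside the interval.\<close>

lemma skipped_interval_iff:
  assumes ij: "i < j" "j < length C"
  shows "skipped_interval u w C (chain_interval C (C ! i) (C ! j)) \<longleftrightarrow>
    (\<exists>m\<ge>i. shortcut C m j)"
proof
  let ?I = "chain_interval C (C ! i) (C ! j)"
  have I: "?I = (!) C ` {i<..<j}" using saturated_chain_interval[OF sat] ij by simp
  have notI: "C ! k \<notin> ?I" if "k < length C" "k \<le> i \<or> j \<le> k" for k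
    using that ij unfolding I
    by (auto dest!: inj_onD[OF saturated_inj[OF sat]])
  {
    assume "skipped_interval u w C ?I"
    then obtain C' where max: "maximal_chain u w C'" and less: "chain_less w C' C"
      and sub: "set C - ?I \<subseteq> set C'"
      by (auto simp: skipped_interval_def)
    have "sublist u w"
      using saturated_sublist[OF sat, of "length C - Suc 0" 0] saturated_length_pos[OF sat]
      by (simp add: saturated_nth_0[OF sat] saturated_nth_last[OF sat])
    then have C': "saturated u w C'" using max by (rule maximal_chain_imp_saturated)
    have len: "length C' = length C"
      using saturated_length[OF sat] saturated_length[OF C'] by simp
    \<comment> \<open>Common elements of two saturated chains have the same index, since their
      length determines it.\<close>
    have agree: "C' ! k = C ! k" if k: "k < length C" "k \<le> i \<or> j \<le> k" for k
    proof -
      have "C ! k \<in> set C'" using notI[OF k] sub k(1) by auto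
      then obtain q where q: "q < length C'" "C ! k = C' ! q" by (auto simp: in_set_conv_nth)
      then have "q = k"
        using saturated_nth_length[OF sat k(1)] saturated_nth_length[OF C' q(1)] by simp
      with q show ?thesis by simp
    qed
    from less obtain m where m: "Suc m < length C" "C' ! Suc m = tl (C ! m)"
      "C ! Suc m \<noteq> tl (C ! m)"
      by (auto simp: chain_less_iff[OF sat C'])
    then have "\<not> (Suc m \<le> i \<or> j \<le> Suc m)" using agree[of "Suc m"] by auto
    then have im: "i \<le> m" "m < j" by linarith+
    have "sublist (C' ! j) (C' ! Suc m)" using saturated_sublist[OF C'] im ij len by simp
    then have "shortcut C m j" using im m agree[of j] ij by (simp add: shortcut_def)
    with im show "\<exists>m\<ge>i. shortcut C m j" by blast
  next
    assume "\<exists>m\<ge>i. shortcut C m j"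
    then obtain m where m: "i \<le> m" "shortcut C m j" by blast
    then have gap: "Suc m < j" using shortcut_gap ij by blast
    from shortcut_imp_chain[OF m(2) ij(2)] obtain C' where C': "saturated u w C'"
      "chain_less w C' C" "\<And>k. k < length C \<Longrightarrow> k \<le> m \<or> j \<le> k \<Longrightarrow> C ! k \<in> set C'"
      by blast
    have "set C - ?I \<subseteq> set C'"
    proof
      fix x assume x: "x \<in> set C - ?I"
      then obtain k where k: "k < length C" "x = C ! k" by (auto simp: in_set_conv_nth)
      with x have "k \<le> i \<or> j \<le> k" unfolding I by (force simp: not_le[symmetric])
      then show "x \<in> set C'" using C'(3)[OF k(1)] k(2) m(1) by auto
    qed
    moreover have "?I \<noteq> {}"
      unfolding I using greaterThanLessThan_iff[of "Suc m" i j] gap m(1) by fastforce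
    ultimately show "skipped_interval u w C ?I"
      unfolding skipped_interval_def
      using ij C'(2) saturated_imp_maximal_chain[OF C'(1)] by blast
  }
qed

text \<open>Inclusion of nonempty open intervals is inclusion of index ranges, so minimality among
  skipped intervals becomes minimality among shortcuts.\<close>

lemma MSI_iff_shortcut:
  assumes ij: "i < j" "j < length C"
  shows "MSI u w C (chain_interval C (C ! i) (C ! j)) \<longleftrightarrow>
    shortcut C i j \<and> (\<forall>m j'. i \<le> m \<longrightarrow> j' \<le> j \<longrightarrow> shortcut C m j' \<longrightarrow> m = i \<and> j' = j)"
    (is "?L \<longleftrightarrow> ?R")
proof -
  let ?I = "\<lambda>a b. chain_interval C (C ! a) (C ! b)"
  have I: "?I a b = (!) C ` {a<..<b}" if "a < b" "b < length C" for a b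
    using that by (intro saturated_chain_interval[OF sat]) auto
  \<comment> \<open>\<open>Suc a < b\<close> keeps the left interval nonempty; an empty one would
    not constrain the endpoints.\<close>
  have subset: "?I a b \<subseteq> ?I c d \<longleftrightarrow> c \<le> a \<and> b \<le> d"
    if "Suc a < b" "b < length C" "c < d" "d < length C" for a b c d
  proof -
    have "?I a b \<subseteq> ?I c d \<longleftrightarrow> (!) C ` {a<..<b} \<subseteq> (!) C ` {c<..<d}"
      using I[of a b] I[of c d] that by simp
    also have "\<dots> \<longleftrightarrow> {a<..<b} \<subseteq> {c<..<d}"
    proof
      assume sub: "(!) C ` {a<..<b} \<subseteq> (!) C ` {c<..<d}"
      show "{a<..<b} \<subseteq> {c<..<d}"
      proof
        fix x assume x: "x \<in> {a<..<b}"
        then have "C ! x \<in> (!) C ` {c<..<d}" using sub by blast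
        moreover have "x \<in> {..<length C}" "{c<..<d} \<subseteq> {..<length C}" using x that by auto
        ultimately show "x \<in> {c<..<d}"
          using inj_on_image_mem_iff[OF saturated_inj[OF sat]] by blast
      qed
    qed (rule image_mono)
    also have "\<dots> \<longleftrightarrow> c \<le> a \<and> b \<le> d"
    proof
      assume sub: "{a<..<b} \<subseteq> {c<..<d}"
      have "Suc a \<in> {a<..<b}" "b - 1 \<in> {a<..<b}" using that by auto
      with sub have "Suc a \<in> {c<..<d}" "b - 1 \<in> {c<..<d}" by blast+
      then show "c \<le> a \<and> b \<le> d" by auto
    qed auto
    finally show ?thesis .
  qed
  show ?thesis
  proof
    assume msi: ?L
    then obtain m where m: "i \<le> m" "shortcut C m j"
      using skipped_interval_iff[OF ij] by (auto simp: MSI_def)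
    have min: "a = i \<and> b = j" if ab: "i \<le> a" "b \<le> j" "shortcut C a b" for a b
    proof -
      have b: "b < length C" using ab ij by simp
      have gap: "Suc a < b" using shortcut_gap[OF ab(3) b] .
      then have "a < b" by simp
      have "skipped_interval u w C (?I a b)"
        using skipped_interval_iff[OF \<open>a < b\<close> b] ab(3) by blast
      then have "\<not> ?I a b \<subset> ?I i j" using msi by (auto simp: MSI_def)
      moreover have "?I a b \<subseteq> ?I i j" using subset[OF gap b ij] ab by simp
      ultimately have "?I i j \<subseteq> ?I a b" by blast
      moreover have "Suc i < j" using gap ab by linarith
      ultimately show ?thesis using subset[of i j a b] ij \<open>a < b\<close> b ab by simp
    qed
    from min[OF m(1) _ m(2)] m(2) have "shortcut C i j" by simp
    with min show ?R by blast
  next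
    assume R: ?R
    then have sc: "shortcut C i j" by blast
    have "False" if J: "skipped_interval u w C J" "J \<subset> ?I i j" for J
    proof -
      from J(1) obtain a b where ab: "a < b" "b < length C" "J = ?I a b"
        by (auto simp: skipped_interval_def)
      with J(1) obtain m where m: "a \<le> m" "shortcut C m b"
        using skipped_interval_iff by blast
      have gap: "Suc a < b" using shortcut_gap[OF m(2) ab(2)] m(1) by simp
      have "i \<le> a \<and> b \<le> j" using J(2) ab subset[OF gap ab(2) ij] by auto
      with R m have "m = i" "b = j" by (auto dest: order_trans)
      with m \<open>i \<le> a \<and> b \<le> j\<close> have "a = i" by simp
      with \<open>b = j\<close> J(2) ab(3) show False by simp
    qed
    moreover have "skipped_interval u w C (?I i j)" using skipped_interval_iff[OF ij] sc by blast
    ultimately show ?L by (auto simp: MSI_def)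
  qed
qed

end

subsection \<open>Descents and borders\<close>

context
  fixes u w :: "'a list" and C
  assumes sat: "saturated u w C"
begin

text \<open>After a left deletion the block starts further right, so the next label is larger. After
  a right deletion the next label is smaller, whichever end it takes.\<close>

lemma descent_iff:
  assumes k: "Suc (Suc k) < length C"
  shows "label w C (Suc (Suc k)) < label w C (Suc k) \<longleftrightarrow> C ! Suc k \<noteq> tl (C ! k)"
proof -
  obtain n where "length (C ! k) = Suc n" "length (C ! Suc k) = n" "0 < n"
    using saturated_covers[OF sat, of k] saturated_covers[OF sat k] k by (auto simp: covers_def)
  then show ?thesis
    using label_saturated[OF sat, of k] label_saturated[OF sat k] k by auto
qed

text \<open>Two right deletions lower the label by one, right followed by left lowers it by
  \<open>length (C ! k) - 1\<close>. Only the latter drop can exceed one, and it does so from three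
  letters on.\<close>

lemma strong_descent_iff:
  "strong_descent w C (Suc k) \<longleftrightarrow> Suc (Suc k) < length C \<and>
    C ! Suc k \<noteq> tl (C ! k) \<and> C ! Suc (Suc k) = tl (C ! Suc k) \<and> 2 < length (C ! k)"
proof (cases "Suc (Suc k) < length C")
  case k: True
  obtain n where "length (C ! k) = Suc n" "length (C ! Suc k) = n" "0 < n"
    using saturated_covers[OF sat, of k] saturated_covers[OF sat k] k by (auto simp: covers_def)
  then show ?thesis
    using label_saturated[OF sat, of k] label_saturated[OF sat k] k
    by (auto simp: strong_descent_def)
qed (simp add: strong_descent_def)

text \<open>A label drops exactly after a right deletion, so the step into \<open>C ! j\<close> may
  go either way; hence the bound \<open>Suc m < j\<close>. The conjunct \<open>Suc i < j\<close> is
  the convention on single labels.\<close>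

lemma decreasing_labels_iff:
  assumes "j < length C"
  shows "decreasing_labels (map (label w C) [i + 1..<j + 1]) \<longleftrightarrow>
    Suc i < j \<and> (\<forall>m. i \<le> m \<longrightarrow> Suc m < j \<longrightarrow> C ! Suc m \<noteq> tl (C ! m))"
proof -
  let ?l = "map (label w C) [i + 1..<j + 1]"
  have nth: "?l ! k = label w C (Suc (i + k))" if "k < j - i" for k
    using that by (simp del: upt_Suc)
  have "sorted_wrt (>) ?l \<longleftrightarrow> successively (>) ?l"
    by (rule successively_conv_sorted_wrt[symmetric]) (auto simp: transp_def)
  also have "\<dots> \<longleftrightarrow> (\<forall>k. Suc k < j - i \<longrightarrow> ?l ! Suc k < ?l ! k)"
  proof -
    have "length ?l = j - i" by (simp del: upt_Suc)
    then show ?thesis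
      using successively_nthI[of ?l "(>)"] successively_nthD[of "(>)" ?l] by metis
  qed
  also have "\<dots> \<longleftrightarrow> (\<forall>k. Suc k < j - i \<longrightarrow> C ! Suc (i + k) \<noteq> tl (C ! (i + k)))"
    using assms descent_iff by (intro iff_allI imp_cong refl) (simp add: nth del: upt_Suc)
  also have "\<dots> \<longleftrightarrow> (\<forall>m. i \<le> m \<longrightarrow> Suc m < j \<longrightarrow> C ! Suc m \<noteq> tl (C ! m))"
  proof safe
    fix m
    assume "\<forall>k. Suc k < j - i \<longrightarrow> C ! Suc (i + k) \<noteq> tl (C ! (i + k))"
      "i \<le> m" "Suc m < j" "C ! Suc m = tl (C ! m)"
    then show False by (elim allE[of _ "m - i"]) auto
  qed auto
  finally show ?thesis by (auto simp: decreasing_labels_def)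
qed

lemma prefix_if_no_tl:
  assumes "k < length C" "i \<le> k" "\<And>m. i \<le> m \<Longrightarrow> m < k \<Longrightarrow> C ! Suc m \<noteq> tl (C ! m)"
  shows "prefix (C ! k) (C ! i)"
  using assms(2,1,3)
proof (induction k rule: dec_induct)
  case (step n)
  have "C ! Suc n = butlast (C ! n)"
    using covers_cases[OF saturated_covers[OF sat step.prems(1)]] step by auto
  then have "prefix (C ! Suc n) (C ! n)" by (simp add: prefixeq_butlast)
  moreover have "prefix (C ! n) (C ! i)" using step by simp
  ultimately show ?case by (rule prefix_order.order_trans)
qed simp

end

section \<open>Borders, the outer word and the inner word\<close>

lemma outer_border:
  assumes "w \<noteq> []"
  shows "strict_prefix (outer w) w" "strict_suffix (outer w) w"
    and "\<And>x. strict_prefix x w \<Longrightarrow> strict_suffix x w \<Longrightarrow> length x \<le> length (outer w)"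
proof -
  let ?P = "\<lambda>x. strict_prefix x w \<and> strict_suffix x w"
  \<comment> \<open>\<open>[]\<close> is a border and border lengths are bounded, so the maximum
    defining \<open>outer\<close> is attained.\<close>
  have "?P []" using assms by (simp add: strict_suffix_def strict_prefix_def)
  moreover have "\<forall>y. ?P y \<longrightarrow> length y < length w"
    by (auto dest: prefix_length_less)
  ultimately have "?P (arg_max length ?P) \<and> (\<forall>y. ?P y \<longrightarrow> length y \<le> length (arg_max length ?P))"
    by (rule arg_max_nat_lemma)
  then show "strict_prefix (outer w) w" "strict_suffix (outer w) w"
    "\<And>x. strict_prefix x w \<Longrightarrow> strict_suffix x w \<Longrightarrow> length x \<le> length (outer w)"
    by (auto simp: outer_def)
qed

lemma prefix_length_eq: "prefix x w \<Longrightarrow> prefix y w \<Longrightarrow> length x = length y \<Longrightarrow> x = y"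
  by (metis prefix_length_prefix order_refl prefix_order.antisym)

text \<open>An occurrence avoiding the first letter either reaches the end of \<open>x\<close> or
  avoids the last letter too. This separates borders from factors of the inner word.\<close>

lemma sublist_tl_cases:
  assumes "sublist y (tl x)"
  shows "suffix y (tl x) \<or> sublist y (inner x)"
proof -
  from assms obtain ps ss where x: "tl x = ps @ y @ ss" by (auto simp: sublist_def)
  show ?thesis
  proof (cases "ss = []")
    case True
    with x show ?thesis by (auto simp: suffix_def)
  next
    case False
    with x show ?thesis by (auto simp: inner_def butlast_append)
  qed
qed

lemma strict_suffix_iff_tl: "strict_suffix y x \<longleftrightarrow> x \<noteq> [] \<and> suffix y (tl x)"
  by (cases x) (auto simp: strict_suffix_def suffix_Cons dest: suffix_length_le)

lemma tl_butlast_eq_inner: "tl (butlast x) = inner x"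
  by (simp add: inner_def butlast_tl)

lemma sublist_tl_mono: "sublist x y \<Longrightarrow> sublist (tl x) (tl y)"
proof -
  assume "sublist x y"
  then obtain ps ss where y: "y = ps @ x @ ss" by (auto simp: sublist_def)
  show ?thesis
  proof (cases "x = []")
    case False
    then have "tl y = (if ps = [] then tl x @ ss else tl ps @ [hd x] @ tl x @ ss)"
      using y by simp
    then show ?thesis by (metis append.assoc sublist_append_rightI sublist_appendI)
  qed simp
qed

section \<open>Minimal shortcuts as strong descents or outer words\<close>

theorem theorem2p6:
  fixes u w :: "'a list" and C :: "'a list list" and i j :: nat
  assumes "sublist u w"
    and "maximal_chain u w C"
    and "i < j" and "j < length C"
  shows "MSI u w C (chain_interval C (C ! i) (C ! j)) \<longleftrightarrow>
    (chain_interval C (C ! i) (C ! j) = {C ! (i + 1)} \<and> strong_descent w C (i + 1)) \<or>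
    (C ! j = outer (C ! i) \<and> \<not> strict_sublist (outer (C ! i)) (inner (C ! i)) \<and>
     decreasing_labels (map (label w C) [i + 1..<j + 1]))"
proof -
  have sat: "saturated u w C" using assms(1,2) by (rule maximal_chain_imp_saturated)
  note ij = \<open>i < j\<close> \<open>j < length C\<close>
  let ?v = "\<lambda>k. C ! k"
  have cov: "covers (?v k) (?v (Suc k))" if "k < j" for k
    using saturated_covers[OF sat] that ij by simp
  have ne: "?v k \<noteq> []" if "k < j" for k
    using cov[OF that] by (auto simp: covers_def)
  have len: "length (?v k) + k = length w" if "k \<le> j" for k
    using saturated_nth_length[OF sat] that ij by simp
  have right: "?v (Suc k) = butlast (?v k)" if "k < j" "?v (Suc k) \<noteq> tl (?v k)" for k
    using covers_cases[OF cov[OF that(1)]] that(2) by simp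
  have gap: "Suc m < k" if "shortcut C m k" "k \<le> j" for m k
    using shortcut_gap[OF sat that(1)] that(2) ij by simp
  have single: "?v (Suc i) = butlast (?v i) \<and> ?v (Suc (Suc i)) = inner (?v i)"
    if "Suc i < j" "?v (Suc i) \<noteq> tl (?v i)" "?v (Suc (Suc i)) = tl (?v (Suc i))" for i
    using that right[of i] by (simp add: tl_butlast_eq_inner)
  have singleton: "chain_interval C (?v i) (?v j) = {?v (i + 1)}" if "j = Suc (Suc i)"
  proof -
    have "{i<..<j} = {Suc i}" using that by auto
    then show ?thesis using saturated_chain_interval[OF sat, of i j] ij by simp
  qed
  \<comment> \<open>Right then left strips both end letters, and the inner word is also a prefix of
    \<open>tl (C ! k)\<close>.\<close>
  have shortcut_RL: "shortcut C k (Suc (Suc k))"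
    if "Suc k < j" "?v (Suc k) \<noteq> tl (?v k)" "?v (Suc (Suc k)) = tl (?v (Suc k))" for k
    using single[OF that] that(2) by (simp add: shortcut_def inner_def)
  show ?thesis
    unfolding MSI_iff_shortcut[OF sat ij] decreasing_labels_iff[OF sat ij(2)]
  proof (intro iffI; (elim conjE disjE)?)
    assume sc: "shortcut C i j"
      and min: "\<forall>m j'. i \<le> m \<longrightarrow> j' \<le> j \<longrightarrow> shortcut C m j' \<longrightarrow> m = i \<and> j' = j"
    have gap_ij: "Suc i < j" using gap[OF sc] by simp
    have R1: "?v (Suc i) \<noteq> tl (?v i)" and subtl: "sublist (?v j) (tl (?v i))"
      using sc by (auto simp: shortcut_def)
    show "(chain_interval C (?v i) (?v j) = {?v (i + 1)} \<and> strong_descent w C (i + 1)) \<or>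
      ?v j = outer (?v i) \<and> \<not> strict_sublist (outer (?v i)) (inner (?v i)) \<and>
      Suc i < j \<and> (\<forall>m. i \<le> m \<longrightarrow> Suc m < j \<longrightarrow> ?v (Suc m) \<noteq> tl (?v m))"
    proof (cases "\<exists>q. i \<le> q \<and> q < j \<and> ?v (Suc q) = tl (?v q)")
      case True
      \<comment> \<open>The first left deletion. The step before it goes right, and this pair alone
        is a shortcut, so by minimality it fills the interval.\<close>
      define q where "q = (LEAST q. i \<le> q \<and> q < j \<and> ?v (Suc q) = tl (?v q))"
      have q: "i \<le> q" "q < j" "?v (Suc q) = tl (?v q)"
        using LeastI_ex[OF True] by (auto simp: q_def)
      have before: "?v (Suc m) \<noteq> tl (?v m)" if "i \<le> m" "m < q" for m
        using not_less_Least[of m "\<lambda>q. i \<le> q \<and> q < j \<and> ?v (Suc q) = tl (?v q)"] that q(2)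
        by (auto simp: q_def[symmetric])
      have "q \<noteq> i" using q(3) R1 by auto
      with q(1) obtain p where p: "q = Suc p" "i \<le> p" by (cases q) auto
      have "shortcut C p (Suc (Suc p))"
        using shortcut_RL[of p] p q before[of p] by simp
      moreover have "Suc (Suc p) \<le> j" using p q by simp
      ultimately have "p = i \<and> Suc (Suc p) = j" using min p(2) by blast
      then have j: "p = i" "j = Suc (Suc i)" by auto
      have L2: "?v (Suc (Suc i)) = tl (?v (Suc i))" using q(3) unfolding p(1) j(1) .
      have dec: "\<forall>m. i \<le> m \<longrightarrow> Suc m < j \<longrightarrow> ?v (Suc m) \<noteq> tl (?v m)"
        using before p j by auto
      show ?thesis
      \<comment> \<open>From a two-letter word the descent is not strong. Its letters are distinct,
        so its outer word is empty, as is \<open>C ! j\<close>, and the second alternative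
        holds.\<close>
      proof (cases "2 < length (?v i)")
        case True
        then have "strong_descent w C (i + 1)"
          using strong_descent_iff[OF sat, of i] j(2) R1 L2 ij(2) by simp
        then show ?thesis using singleton j by simp
      next
        case False
        moreover have "2 \<le> length (?v i)" using len[of i] len[of j] j by simp
        ultimately have two: "length (?v i) = 2" by simp
        then have vj: "?v j = []" using len[of i] len[of j] j by simp
        obtain x y where xy: "?v i = [x, y]"
          using two by (auto simp: numeral_2_eq_2 length_Suc_conv)
        have "x \<noteq> y" using R1 right[of i] xy ij by simp
        have "outer (?v i) = []"
        proof (rule ccontr)
          assume "outer (?v i) \<noteq> []"
          moreover have "strict_prefix (outer (?v i)) [x, y]" "strict_suffix (outer (?v i)) [x, y]"
            using outer_border[of "?v i"] xy by simp_all
          ultimately show False using \<open>x \<noteq> y\<close>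
            by (auto simp: strict_prefix_def prefix_Cons strict_suffix_def suffix_Cons)
        qed
        then show ?thesis using vj dec gap_ij xy by (simp add: inner_def strict_sublist_def)
      qed
    next
      case False
      then have R: "?v (Suc m) \<noteq> tl (?v m)" if "i \<le> m" "m < j" for m using that by blast
      have pre: "prefix (?v k) (?v i)" if "i \<le> k" "k \<le> j" for k
        using prefix_if_no_tl[OF sat] R that ij by simp
      \<comment> \<open>The inner word is \<open>tl (C ! Suc i)\<close>, so a factor of it would
        give a second shortcut, from \<open>Suc i\<close> to \<open>j\<close>.\<close>
      have not_inner: "\<not> sublist (?v j) (inner (?v i))"
      proof
        assume "sublist (?v j) (inner (?v i))"
        then have "shortcut C (Suc i) j"
          using R[of "Suc i"] right[OF _ R1] gap_ij by (simp add: shortcut_def tl_butlast_eq_inner)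
        with min have "Suc i = i" by (meson le_SucI order_refl)
        then show False by simp
      qed
      have "strict_suffix (?v j) (?v i)"
        using sublist_tl_cases[OF subtl] not_inner ne[of i] ij by (simp add: strict_suffix_iff_tl)
      moreover have "strict_prefix (?v j) (?v i)"
        using pre[of j] len[of i] len[of j] ij by (auto simp: strict_prefix_def)
      ultimately have le: "length (?v j) \<le> length (outer (?v i))"
        using outer_border(3)[of "?v i"] ne ij by blast
      have o: "strict_prefix (outer (?v i)) (?v i)" "strict_suffix (outer (?v i)) (?v i)"
        using outer_border[of "?v i"] ne ij by blast+
      \<comment> \<open>The index where the chain reaches the length of the outer word. Both words
        are prefixes of \<open>C ! i\<close>, so they agree; minimality then yields
        \<open>k = j\<close>.\<close>
      define k where "k = length w - length (outer (?v i))"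
      have lt: "length (outer (?v i)) < length (?v i)" using o(1) by (rule prefix_length_less)
      have k: "i < k" "k \<le> j" using lt le len[of i] len[of j] ij by (auto simp: k_def)
      have "length (?v k) = length (outer (?v i))"
        using len[of k] len[of i] k lt ij by (simp add: k_def)
      then have vk: "?v k = outer (?v i)"
        using prefix_length_eq[of "?v k" "?v i" "outer (?v i)"] pre[of k] k o(1)
        by (simp add: strict_prefix_def)
      have "shortcut C i k"
        using k R1 o(2) vk by (simp add: shortcut_def strict_suffix_iff_tl)
      with min k(2) have "k = j" by blast
      with vk not_inner R gap_ij show ?thesis
        by (auto simp: strict_sublist_def)
    qed
  next
    assume I: "chain_interval C (?v i) (?v j) = {?v (i + 1)}" and "strong_descent w C (i + 1)"
    then have sd: "?v (Suc i) \<noteq> tl (?v i)" "?v (Suc (Suc i)) = tl (?v (Suc i))"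
      using strong_descent_iff[OF sat, of i] by auto
    \<comment> \<open>The interval is given as a set of words; injectivity of indexing recovers
      \<open>j = Suc (Suc i)\<close>.\<close>
    have "(!) C ` {i<..<j} = (!) C ` {Suc i}"
      using I saturated_chain_interval[OF sat, of i j] ij by simp
    moreover have "{i<..<j} \<subseteq> {..<length C}" "{Suc i} \<subseteq> {..<length C}" using ij by auto
    ultimately have "{i<..<j} = {Suc i}"
      using inj_on_image_eq_iff[OF saturated_inj[OF sat], of "{i<..<j}" "{Suc i}"] by blast
    then have "Suc i \<in> {i<..<j}" "Suc (Suc i) \<notin> {i<..<j}" by simp_all
    then have j: "j = Suc (Suc i)" by auto
    then have "shortcut C i j" using shortcut_RL[of i] sd by simp
    moreover have "m = i \<and> j' = j" if "i \<le> m" "j' \<le> j" "shortcut C m j'" for m j'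
      using gap[OF that(3,2)] that j by auto
    ultimately show "shortcut C i j \<and>
      (\<forall>m j'. i \<le> m \<longrightarrow> j' \<le> j \<longrightarrow> shortcut C m j' \<longrightarrow> m = i \<and> j' = j)" by blast
  next
    assume vj: "?v j = outer (?v i)"
      and not_inner: "\<not> strict_sublist (outer (?v i)) (inner (?v i))"
      and gap_ij: "Suc i < j"
      and R: "\<forall>m. i \<le> m \<longrightarrow> Suc m < j \<longrightarrow> ?v (Suc m) \<noteq> tl (?v m)"
    have vi: "?v i \<noteq> []" using ne ij by simp
    have R1: "?v (Suc i) \<noteq> tl (?v i)" using R gap_ij by simp
    \<comment> \<open>Stops before \<open>j\<close>, since decreasing labels leave the last step
      open.\<close>
    have pre: "prefix (?v k) (?v i)" if "i \<le> k" "k < j" for k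
      using prefix_if_no_tl[OF sat, of k i] R that ij by simp
    have "shortcut C i j"
      using R1 outer_border(2)[OF vi] vj ij by (simp add: shortcut_def strict_suffix_iff_tl)
    moreover have "m = i \<and> j' = j" if m: "i \<le> m" "j' \<le> j" "shortcut C m j'" for m j'
    proof -
      have g: "Suc m < j'" using gap[OF m(3,2)] .
      have sub: "sublist (?v j') (tl (?v m))" using m(3) by (simp add: shortcut_def)
      have jj': "sublist (?v j) (?v j')" using saturated_sublist[OF sat] m ij by simp
      \<comment> \<open>A shortcut starting after \<open>i\<close> would put \<open>C ! j\<close>
        inside the inner word, strictly so because at least three letters are lost from
        \<open>C ! i\<close>.\<close>
      have "m = i"
      proof (rule ccontr)
        assume "m \<noteq> i"
        then have mi: "Suc i \<le> m" using m by simp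
        then have "sublist (?v m) (?v (Suc i))" using saturated_sublist[OF sat] g m ij by simp
        then have "sublist (tl (?v m)) (inner (?v i))"
          using right[OF _ R1] ij by (metis sublist_tl_mono tl_butlast_eq_inner)
        then have "sublist (?v j) (inner (?v i))"
          using sub jj' by (meson sublist_order.order_trans)
        moreover have "length (?v j) < length (inner (?v i))"
          using len[of j] len[of i] ij mi g m by (simp add: inner_def)
        ultimately show False using not_inner vj by (auto simp: strict_sublist_def)
      qed
      moreover have "j' = j"
      proof (rule ccontr)
        assume "j' \<noteq> j"
        then have j': "j' < j" using m by simp
        have lt: "length (?v j) < length (?v j')" using len[of j] len[of j'] j' by simp
        have sub: "sublist (?v j') (tl (?v i))" using sub \<open>m = i\<close> by simp
        from sublist_tl_cases[OF this] show False
        proof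
          assume "suffix (?v j') (tl (?v i))"
          then have "strict_suffix (?v j') (?v i)" using vi by (simp add: strict_suffix_iff_tl)
          moreover have "strict_prefix (?v j') (?v i)"
            using pre[of j'] g \<open>m = i\<close> j' len[of i] len[of j'] ij by (auto simp: strict_prefix_def)
          ultimately show False using outer_border(3)[OF vi] lt vj by fastforce
        next
          assume "sublist (?v j') (inner (?v i))"
          then have "sublist (?v j) (inner (?v i))" "length (?v j) < length (inner (?v i))"
            using jj' lt sublist_length_le[of "?v j'" "inner (?v i)"]
            by (meson sublist_order.order_trans, linarith)
          then show False using not_inner vj by (auto simp: strict_sublist_def)
        qed
      qed
      ultimately show ?thesis ..
    qed
    ultimately show "shortcut C i j \<and>
      (\<forall>m j'. i \<le> m \<longrightarrow> j' \<le> j \<longrightarrow> shortcut C m j' \<longrightarrow> m = i \<and> j' = j)" by blast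
  qed
qed

end
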